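(* Let $p$ be a prime with $p\equiv5$ or $7\pmod 8$. Then $S_{\frac{p^2-1}{2}}\equiv0\pmod{p^2}$ and $f_{\frac{p^2-1}{2}}\equiv0\pmod{p^2}$.
   Context: $(S_n)_{n\ge0}$ is the integer sequence defined by $S_0=1$, $S_1=4$ and $(n+1)^2S_{n+1}=4(3n^2+3n+1)S_n-32n^2S_{n-1}$ for $n\ge1$; equivalently $S_n=\sum_{k=0}^n\binom nk\binom{2k}k\binom{2n-2k}{n-k}$. The Franel numbers are $f_n=\sum_{k=0}^n\binom nk^3$. *)

theory Defs
  imports Main "HOL-Computational_Algebra.Primes"
begin

definition S :: "nat \<Rightarrow> nat" where
  "S n = (\<Sum>k=0..n. (n choose k) * ((2*k) choose k) * ((2*n - 2*k) choose (n - k)))"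

definition franel :: "nat \<Rightarrow> nat" where
  "franel n = (\<Sum>k=0..n. (n choose k) ^ 3)"

end

theory Submission
  imports Defs "HOL-Number_Theory.Cong" "HOL-Computational_Algebra.Formal_Power_Series"
begin

text \<open>
  Write \<open>p = 2h + 1\<close>, so that \<open>(p\<^sup>2 - 1)/2 = ph + h\<close>. Expand each summand of index \<open>pa + b\<close> by
  Lucas' theorem modulo \<open>p\<^sup>2\<close>: for \<open>b > h\<close> it vanishes because two binomial factors are divisible
  by \<open>p\<close>; for \<open>b \<le> h\<close> it is the summand of index \<open>a\<close> times a quantity affine in \<open>pa\<close>. The symmetry
  \<open>a \<mapsto> h - a\<close> then yields \<open>S\<^bsub>ph+h\<^esub> \<equiv> S\<^sub>h (S\<^sub>h + pX)\<close> modulo \<open>p\<^sup>2\<close>, and likewise for the Franel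
  numbers, so it suffices that \<open>p\<close> divides \<open>S\<^sub>h \<equiv> (-4)\<^sup>h f\<^sub>h\<close>.

  Squaring the exponential generating function of the central binomial coefficients gives
  \<open>S\<^sub>n = \<Sum>\<^sub>k binom(n,2k) binom(2k,k)\<^sup>2 4\<^bsup>n-2k\<^esup>\<close>. With \<open>m = \<lfloor>p/4\<rfloor>\<close>, this is for \<open>n = h\<close> congruent to a
  power of 4 times \<open>\<Sum>\<^sub>k (-1)\<^sup>k binom(m,k) binom(m+k,k) binom(2k,k) 4\<^bsup>m-k\<^esup>\<close>, i.e. to the mean of the
  Legendre polynomial \<open>P\<^sub>m(cos \<theta>)\<close> over the circle. It is zero because \<open>m\<close> is odd when \<open>p\<close> is
  5 or 7 modulo 8.
\<close>

section \<open>Lucas' theorem modulo the square of a prime\<close>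

lemma prime_dvd_choose_mult:
  fixes p :: nat
  assumes "prime p" "\<not> p dvd c"
  shows "p dvd (p * A choose c)"
proof -
  have "c > 0" using assms(2) by (cases c) auto
  then have "c * (p * A choose c) = p * A * (p * A - 1 choose (c - 1))"
    by (rule times_binomial_minus1_eq)
  then have "p dvd c * (p * A choose c)" by simp
  then show ?thesis using assms prime_dvd_mult_iff by blast
qed

text \<open>The case with a carry. Split the upper entry as \<open>B\<close> plus
  \<open>p * A\<close> in Vandermonde's convolution: a nonzero term takes \<open>j \<le> B\<close>
  from the first part, so the rest \<open>p * a + (b - j)\<close> has a nonzero last digit and
  \<open>prime_dvd_choose_mult\<close> applies to the second factor.\<close>

lemma prime_dvd_choose_digits:
  fixes p :: nat
  assumes "prime p" "B < b" "b < p"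
  shows "p dvd (p * A + B choose (p * a + b))"
proof -
  have "(B + p * A choose (p * a + b)) =
      (\<Sum>j\<le>p * a + b. (B choose j) * (p * A choose (p * a + b - j)))"
    by (rule vandermonde[symmetric])
  also have "p dvd \<dots>"
  proof (rule dvd_sum)
    fix j
    show "p dvd (B choose j) * (p * A choose (p * a + b - j))"
    proof (cases "j \<le> B")
      case True
      then have "p * a + b - j = p * a + (b - j)" "0 < b - j" "b - j < p"
        using assms by auto
      then have "\<not> p dvd (p * a + b - j)"
        by (metis dvd_add_right_iff dvd_triv_left nat_dvd_not_less)
      then show ?thesis using prime_dvd_choose_mult[OF assms(1)] by simp
    qed (simp add: binomial_eq_0)
  qed
  finally show ?thesis by (simp add: add.commute)
qed

text \<open>Vandermonde for \<open>p + p * A\<close> is Pascal's rule modulo \<open>p^2\<close>: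
  only \<open>j = 0\<close> and \<open>j = p\<close> survive, since for \<open>0 < j < p\<close>
  both factors are multiples of \<open>p\<close>.\<close>

lemma choose_prime_mult_cong:
  fixes p :: nat
  assumes "prime p"
  shows "[p * A choose (p * a) = A choose a] (mod p\<^sup>2)"
proof (induction A arbitrary: a)
  case 0
  show ?case using prime_gt_0_nat[OF assms] by (cases a) (auto simp: binomial_eq_0)
next
  case (Suc A)
  show ?case
  proof (cases a)
    case (Suc c)
    let ?t = "\<lambda>j. (p choose j) * (p * A choose (p * a - j))"
    have p0: "p > 0" using prime_gt_0_nat[OF assms] .
    have sub: "{0, p} \<subseteq> {..p * a}" using Suc by auto
    have "(p * Suc A choose (p * a)) = (\<Sum>j\<le>p * a. ?t j)"
      using vandermonde[of p "p * A" "p * a"] by simp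
    also have "\<dots> = (\<Sum>j\<in>{..p * a} - {0, p}. ?t j) + (\<Sum>j\<in>{0, p}. ?t j)"
      by (rule sum.subset_diff[OF sub]) simp
    also have "(\<Sum>j\<in>{0, p}. ?t j) = (p * A choose (p * a)) + (p * A choose (p * c))"
      using p0 Suc by simp
    finally have eq: "(p * Suc A choose (p * a)) = (\<Sum>j\<in>{..p * a} - {0, p}. ?t j) +
        ((p * A choose (p * a)) + (p * A choose (p * c)))" .
    have "p\<^sup>2 dvd (\<Sum>j\<in>{..p * a} - {0, p}. ?t j)"
    proof (rule dvd_sum)
      fix j assume j: "j \<in> {..p * a} - {0, p}"
      show "p\<^sup>2 dvd ?t j"
      proof (cases "j < p")
        case True
        then have nd: "\<not> p dvd j" using j by (auto dest: nat_dvd_not_less)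
        then have "\<not> p dvd p * a - j"
          using j by (metis DiffD1 atMost_iff dvd_diffD1 dvd_triv_left)
        then show ?thesis
          using prime_dvd_choose_mult[OF assms nd, of 1] prime_dvd_choose_mult[OF assms]
          by (simp add: power2_eq_square mult_dvd_mono)
      qed (use j in \<open>auto simp: binomial_eq_0\<close>)
    qed
    then have "[(\<Sum>j\<in>{..p * a} - {0, p}. ?t j) = 0] (mod p\<^sup>2)"
      by (simp add: cong_0_iff)
    then have "[p * Suc A choose (p * a) = 0 + ((A choose a) + (A choose c))] (mod p\<^sup>2)"
      unfolding eq by (intro cong_add Suc.IH)
    then show ?thesis using Suc by (simp add: add.commute)
  qed simp
qed

text \<open>One induction step of \<open>lucas_mod_prime_square\<close>. Multiplying
  \<open>rec\<close> by \<open>r - p * y\<close> leaves \<open>r\<^sup>2\<close> on the left modulo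
  \<open>p\<^sup>2\<close>, and \<open>e\<^sup>2\<close> inverts it. The new correction is explicit
  and linear in \<open>L\<close>, \<open>x\<close> and \<open>y\<close>, so an expansion that is
  linear in \<open>A\<close> and \<open>a\<close> stays so.\<close>

lemma cong_div_affine:
  fixes X X' C \<beta> \<beta>' r s x y L e :: int and p :: int
  assumes X: "[X = C * (\<beta> + p * L)] (mod p\<^sup>2)"
    and rec: "(r + p * y) * X' = (s + p * x) * X"
    and \<beta>: "r * \<beta>' = s * \<beta>"
    and e: "[e * r = 1] (mod p\<^sup>2)"
  shows "[X' = C * (\<beta>' + p * (e\<^sup>2 * (s * r * L + \<beta> * (r * x - s * y))))] (mod p\<^sup>2)"
proof -
  have "[r\<^sup>2 * X' = r\<^sup>2 * X' - p\<^sup>2 * y\<^sup>2 * X'] (mod p\<^sup>2)"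
    by (simp add: cong_iff_dvd_diff)
  also have "r\<^sup>2 * X' - p\<^sup>2 * y\<^sup>2 * X' = (r - p * y) * ((r + p * y) * X')"
    by (simp add: algebra_simps power2_eq_square)
  also have "\<dots> = (r - p * y) * ((s + p * x) * X)" unfolding rec ..
  also have "[\<dots> = (r - p * y) * ((s + p * x) * (C * (\<beta> + p * L)))] (mod p\<^sup>2)"
    by (intro cong_mult cong_refl X)
  also have "(r - p * y) * ((s + p * x) * (C * (\<beta> + p * L))) =
      C * (r * (s * \<beta>) + p * (s * r * L + \<beta> * (r * x - s * y)))
      + p\<^sup>2 * (C * (r * x * L - y * (s * L + x * \<beta> + p * x * L)))"
    by (simp add: algebra_simps power2_eq_square)
  also have "[\<dots> = C * (r * (s * \<beta>) + p * (s * r * L + \<beta> * (r * x - s * y)))] (mod p\<^sup>2)"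
    by (simp add: cong_iff_dvd_diff)
  finally have main: "[r\<^sup>2 * X' = C * (r\<^sup>2 * \<beta>' + p * (s * r * L + \<beta> * (r * x - s * y)))] (mod p\<^sup>2)"
    unfolding \<beta>[symmetric] by (simp add: power2_eq_square mult.assoc)
  have e2: "[(e * r)\<^sup>2 = 1] (mod p\<^sup>2)" using cong_pow[OF e, of 2] by simp
  have "[X' = (e * r)\<^sup>2 * X'] (mod p\<^sup>2)"
    using cong_scalar_right[OF e2, of X'] by (simp add: cong_sym)
  also have "(e * r)\<^sup>2 * X' = e\<^sup>2 * (r\<^sup>2 * X')" by (simp add: power_mult_distrib)
  also have "[\<dots> = e\<^sup>2 * (C * (r\<^sup>2 * \<beta>' + p * (s * r * L + \<beta> * (r * x - s * y))))] (mod p\<^sup>2)"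
    by (rule cong_scalar_left[OF main])
  also have "e\<^sup>2 * (C * (r\<^sup>2 * \<beta>' + p * (s * r * L + \<beta> * (r * x - s * y)))) =
      C * ((e * r)\<^sup>2 * \<beta>' + p * (e\<^sup>2 * (s * r * L + \<beta> * (r * x - s * y))))"
    by (simp add: algebra_simps power_mult_distrib)
  also have "[\<dots> = C * (1 * \<beta>' + p * (e\<^sup>2 * (s * r * L + \<beta> * (r * x - s * y))))] (mod p\<^sup>2)"
    by (intro cong_mult cong_add cong_refl e2)
  finally show ?thesis by simp
qed

text \<open>The order of the quantifiers matters: \<open>u\<close> and \<open>v\<close> depend only
  on the digits \<open>B\<close> and \<open>b\<close>, which makes the later summation over
  \<open>a\<close> possible. Induction on \<open>B\<close> starts from
  \<open>choose_prime_mult_cong\<close>; each step uses an absorption identity whose divisor has a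
  last digit between 1 and \<open>p - 1\<close>, a unit modulo \<open>p\<^sup>2\<close>.\<close>

lemma lucas_mod_prime_square:
  fixes p :: nat
  assumes "prime p" "b \<le> B" "B < p"
  shows "\<exists>u v. \<forall>A a. a \<le> A \<longrightarrow>
    [int (p * A + B choose (p * a + b)) =
     int (A choose a) * (int (B choose b) + int p * (int A * u + int a * v))] (mod (int p)\<^sup>2)"
  using assms(2,3)
proof (induction B arbitrary: b)
  case 0
  then have "[int (p * A + 0 choose (p * a + b)) = int (A choose a)] (mod (int p)\<^sup>2)" for A a
    using choose_prime_mult_cong[OF assms(1), of A a] by (simp flip: cong_int_iff)
  then show ?case using 0 by (intro exI[of _ 0]) simp
next
  case (Suc B)
  have unit: "\<exists>e. [e * int r = 1] (mod (int p)\<^sup>2)" if "0 < r" "r < p" for r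
  proof -
    have "coprime r p"
      using that assms(1) by (metis coprime_commute nat_dvd_not_less prime_imp_coprime)
    then have "coprime (int r) ((int p)\<^sup>2)" by simp
    then show ?thesis by (metis cong_solve_coprime_int mult.commute)
  qed
  show ?case
  proof (cases b)
    \<comment> \<open>With lower digit 0 only the upper digit grows, through
      \<open>(N + 1 - K) * (N + 1 choose K) = (N + 1) * (N choose K)\<close>; here \<open>r\<close>
      and \<open>s\<close> of \<open>cong_div_affine\<close> are both \<open>Suc B\<close>.\<close>
    case 0
    obtain u v where uv: "\<And>A a. a \<le> A \<Longrightarrow> [int (p * A + B choose (p * a + 0)) =
        int (A choose a) * (int (B choose 0) + int p * (int A * u + int a * v))] (mod (int p)\<^sup>2)"
      using Suc.IH[of 0] Suc.prems by auto
    obtain e where e: "[e * int (Suc B) = 1] (mod (int p)\<^sup>2)"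
      using unit[of "Suc B"] Suc.prems by auto
    show ?thesis
    proof (intro exI allI impI)
      fix A a :: nat assume aA: "a \<le> A"
      let ?N = "p * A + B" and ?K = "p * a"
      have le: "?K \<le> ?N" using aA by (simp add: trans_le_add1)
      have "(Suc ?N - ?K) * (Suc ?N choose ?K) = Suc ?N * (?N choose ?K)"
        using binomial_absorb_comp[of "Suc ?N" ?K] by simp
      then have "int (Suc ?N - ?K) * int (Suc ?N choose ?K) = int (Suc ?N) * int (?N choose ?K)"
        by (metis of_nat_mult)
      moreover have "int (Suc ?N - ?K) = int (Suc B) + int p * (int A - int a)"
        using le by (simp add: of_nat_diff algebra_simps)
      ultimately have rec: "(int (Suc B) + int p * (int A - int a)) * int (Suc ?N choose ?K) =
          (int (Suc B) + int p * int A) * int (?N choose ?K)"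
        by simp
      have "[int (Suc ?N choose ?K) = int (A choose a) * (1 + int p * (e\<^sup>2 *
          (int (Suc B) * int (Suc B) * (int A * u + int a * v) + 1 *
            (int (Suc B) * int A - int (Suc B) * (int A - int a)))))] (mod (int p)\<^sup>2)"
        by (rule cong_div_affine[OF _ rec _ e]) (use uv[OF aA] in auto)
      also have "e\<^sup>2 * (int (Suc B) * int (Suc B) * (int A * u + int a * v) + 1 *
            (int (Suc B) * int A - int (Suc B) * (int A - int a))) =
          int A * (e\<^sup>2 * int (Suc B) * int (Suc B) * u) +
          int a * (e\<^sup>2 * (int (Suc B) * int (Suc B) * v + int (Suc B)))"
        by (simp only: algebra_simps mult_1_left)
      finally show "[int (p * A + Suc B choose (p * a + b)) = int (A choose a) *
          (int (Suc B choose b) + int p * (int A * (e\<^sup>2 * int (Suc B) * int (Suc B) * u) +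
          int a * (e\<^sup>2 * (int (Suc B) * int (Suc B) * v + int (Suc B)))))] (mod (int p)\<^sup>2)"
        using 0 by simp
    qed
  next
    \<comment> \<open>With a positive lower digit both digits grow together, by absorption; the
      divisor \<open>Suc ?K\<close> has last digit \<open>Suc c\<close>.\<close>
    case (Suc c)
    obtain u v where uv: "\<And>A a. a \<le> A \<Longrightarrow> [int (p * A + B choose (p * a + c)) =
        int (A choose a) * (int (B choose c) + int p * (int A * u + int a * v))] (mod (int p)\<^sup>2)"
      using Suc.IH[of c] Suc.prems Suc by auto
    obtain e where e: "[e * int (Suc c) = 1] (mod (int p)\<^sup>2)"
      using unit[of "Suc c"] Suc.prems Suc by auto
    have \<beta>: "int (Suc c) * int (Suc B choose Suc c) = int (Suc B) * int (B choose c)"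
      by (metis Suc_times_binomial_eq mult.commute of_nat_mult)
    show ?thesis
    proof (intro exI allI impI)
      fix A a :: nat assume aA: "a \<le> A"
      let ?N = "p * A + B" and ?K = "p * a + c"
      have "int (Suc ?K) * int (Suc ?N choose Suc ?K) = int (Suc ?N) * int (?N choose ?K)"
        by (metis Suc_times_binomial_eq mult.commute of_nat_mult)
      then have rec: "(int (Suc c) + int p * int a) * int (Suc ?N choose Suc ?K) =
          (int (Suc B) + int p * int A) * int (?N choose ?K)"
        by (simp add: algebra_simps)
      have "[int (Suc ?N choose Suc ?K) = int (A choose a) * (int (Suc B choose Suc c) + int p * (e\<^sup>2 *
          (int (Suc B) * int (Suc c) * (int A * u + int a * v) + int (B choose c) *
            (int (Suc c) * int A - int (Suc B) * int a))))] (mod (int p)\<^sup>2)"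
        by (rule cong_div_affine[OF uv[OF aA] rec \<beta> e])
      also have "e\<^sup>2 * (int (Suc B) * int (Suc c) * (int A * u + int a * v) + int (B choose c) *
            (int (Suc c) * int A - int (Suc B) * int a)) =
          int A * (e\<^sup>2 * (int (Suc B) * int (Suc c) * u + int (B choose c) * int (Suc c))) +
          int a * (e\<^sup>2 * (int (Suc B) * int (Suc c) * v - int (B choose c) * int (Suc B)))"
        by (simp only: algebra_simps)
      finally show "[int (p * A + Suc B choose (p * a + b)) = int (A choose a) *
          (int (Suc B choose b) + int p *
          (int A * (e\<^sup>2 * (int (Suc B) * int (Suc c) * u + int (B choose c) * int (Suc c))) +
           int a * (e\<^sup>2 * (int (Suc B) * int (Suc c) * v - int (B choose c) * int (Suc B)))))]
          (mod (int p)\<^sup>2)"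
        using Suc by simp
    qed
  qed
qed

section \<open>Vanishing of the circle mean of an odd Legendre polynomial\<close>

lemma central_choose_Suc:
  "Suc j * (2 * Suc j choose Suc j) = 2 * (2 * j + 1) * (2 * j choose j)"
proof -
  have "Suc j * (Suc (2 * j + 1) choose Suc j) = Suc (2 * j + 1) * (2 * j + 1 choose j)"
    by (simp only: Suc_times_binomial_eq mult.commute)
  moreover have "(Suc (2 * j) - j) * (Suc (2 * j) choose j) = Suc (2 * j) * (2 * j choose j)"
    using binomial_absorb_comp[of "Suc (2 * j)" j] by simp
  ultimately show ?thesis by (simp add: algebra_simps)
qed

text \<open>The number \<open>(2 * j choose j) / 4 ^ j\<close> is the mean of \<open>x ^ j\<close>
  over the circle for \<open>x = sin^2 (\<theta> / 2)\<close>, and the invariance expresses the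
  symmetry \<open>x \<mapsto> 1 - x\<close>. Algebraically it is \<open>(-1) ^ j\<close> times the
  binomial coefficient of -1/2, so Vandermonde sums the left side and upper negation brings the
  result back.\<close>

lemma central_choose_binomial_transform:
  "(\<Sum>j\<le>k. (-1) ^ j * of_nat (k choose j) * (of_nat (2 * j choose j) / 4 ^ j)) =
    (of_nat (2 * k choose k) / 4 ^ k :: rat)"
proof -
  have half: "((- 1 / 2 :: rat) gchoose j) = (- 1) ^ j * (of_nat (2 * j choose j) / 4 ^ j)" for j
  proof (induction j)
    case (Suc j)
    have "rat_of_nat (Suc j * (2 * Suc j choose Suc j)) = of_nat (2 * (2 * j + 1) * (2 * j choose j))"
      by (simp only: central_choose_Suc)
    then have 1: "of_nat (Suc j) * rat_of_nat (2 * Suc j choose Suc j)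
        = 2 * (2 * of_nat j + 1) * rat_of_nat (2 * j choose j)"
      by (simp only: of_nat_mult of_nat_add of_nat_numeral of_nat_1)
    have "of_nat (Suc j) * ((- 1 / 2 :: rat) gchoose Suc j) = (- 1 / 2 - of_nat j) * ((- 1 / 2) gchoose j)"
      by (simp only: gbinomial_absorb_comp gbinomial_absorption)
    also have "\<dots> = of_nat (Suc j) * ((- 1) ^ Suc j * (of_nat (2 * Suc j choose Suc j) / 4 ^ Suc j))"
      unfolding Suc mult.left_commute[of "of_nat (Suc j)"] times_divide_eq_right 1
      by (simp add: field_simps)
    finally show ?case by (simp only: mult_cancel_left of_nat_neq_0 simp_thms)
  qed simp
  have "(\<Sum>j\<le>k. (-1) ^ j * of_nat (k choose j) * (of_nat (2 * j choose j) / 4 ^ j)) =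
      (\<Sum>j=0..k. ((- 1 / 2 :: rat) gchoose j) * (of_nat k gchoose (k - j)))"
    unfolding atLeast0AtMost half
    by (rule sum.cong) (auto simp: binomial_gbinomial[symmetric] simp flip: binomial_symmetric)
  also have "\<dots> = (- 1 / 2 + of_nat k) gchoose k" by (rule gbinomial_Vandermonde)
  also have "\<dots> = (- 1) ^ k * ((- 1 / 2 :: rat) gchoose k)"
    by (subst gbinomial_negated_upper) (simp add: algebra_simps)
  also have "\<dots> = of_nat (2 * k choose k) / 4 ^ k"
    unfolding half by (simp flip: power_mult_distrib mult.assoc)
  finally show ?thesis .
qed

text \<open>This is the parity \<open>P_m(-z) = (-1)^m P_m(z)\<close>, read off at the coefficient
  of \<open>x ^ j\<close> with \<open>z = 1 - 2 * x\<close>. Writing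
  \<open>(-1) ^ k * (m + k choose k)\<close> as a binomial coefficient of \<open>-m - 1\<close>,
  trinomial revision extracts the factor with index \<open>j\<close> and Vandermonde sums the
  rest.\<close>

lemma legendre_coefficient_reflection:
  fixes m j :: nat
  assumes "j \<le> m"
  shows "(\<Sum>k\<le>m. (-1) ^ k * of_nat (m choose k) * of_nat (m + k choose k) * of_nat (k choose j)) =
    ((-1) ^ m * of_nat (m choose j) * of_nat (m + j choose j) :: rat)"
proof -
  let ?x = "- of_nat m - 1 :: rat"
  have neg: "(- of_nat n - 1 gchoose k) = ((-1) ^ k * of_nat (n + k choose k) :: rat)" for n k :: nat
    using gbinomial_minus[of "of_nat n + 1 :: rat" k] by (simp add: binomial_gbinomial)
  have rev: "(?x gchoose k) * of_nat (k choose j) = (?x gchoose j) * (?x - of_nat j gchoose (k - j))"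
    if "j \<le> k" for k
    using gbinomial_trinomial_revision[OF that, of ?x] by (simp add: binomial_gbinomial)
  have "(\<Sum>k\<le>m. (-1) ^ k * of_nat (m choose k) * of_nat (m + k choose k) * of_nat (k choose j)) =
      (\<Sum>k\<le>m. of_nat (m choose k) * ((?x gchoose k) * of_nat (k choose j)))"
    unfolding neg by (simp add: mult_ac)
  also have "\<dots> = (\<Sum>k=j..m. of_nat (m choose k) * ((?x gchoose k) * of_nat (k choose j)))"
    by (rule sum.mono_neutral_right) (auto simp: not_le)
  also have "\<dots> = (\<Sum>i=0..m - j. (?x gchoose j) *
      ((?x - of_nat j gchoose i) * (of_nat m gchoose (m - j - i))))"
  proof (rule sum.reindex_bij_witness[of _ "\<lambda>i. i + j" "\<lambda>k. k - j"])
    fix k assume k: "k \<in> {j..m}"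
    then have "of_nat (m choose k) = (of_nat m gchoose (m - j - (k - j)) :: rat)"
      using binomial_symmetric[of k m] by (simp add: binomial_gbinomial)
    then show "(?x gchoose j) * ((?x - of_nat j gchoose (k - j)) *
        (of_nat m gchoose (m - j - (k - j)))) =
        of_nat (m choose k) * ((?x gchoose k) * of_nat (k choose j))"
      using k by (simp add: rev)
  qed (use assms in auto)
  also have "\<dots> = (?x gchoose j) * ((?x - of_nat j) + of_nat m gchoose (m - j))"
    by (simp only: sum_distrib_left[symmetric] gbinomial_Vandermonde)
  also have "(?x - of_nat j) + of_nat m = - of_nat j - 1" by simp
  also have "(?x gchoose j) * (- of_nat j - 1 gchoose (m - j)) =
      (-1) ^ m * of_nat (m choose j) * of_nat (m + j choose j)"
    unfolding neg using assms
    by (simp add: power_add[symmetric] binomial_symmetric[of j m] mult_ac)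
  finally show ?thesis .
qed

text \<open>Up to the factor \<open>4 ^ m\<close> the sum is the mean \<open>W\<close> of
  \<open>P_m(cos \<theta>)\<close>. The symmetry of the moments combined with the parity of
  \<open>P_m\<close> gives \<open>W = (-1) ^ m * W\<close>.\<close>

lemma odd_legendre_central_sum:
  assumes "odd m"
  shows "(\<Sum>k\<le>m. (-1) ^ k * int (m choose k) * int (m + k choose k) * int (2 * k choose k)
    * 4 ^ (m - k)) = 0"
proof -
  define L where "L k = (of_nat (2 * k choose k) / 4 ^ k :: rat)" for k
  define c where "c k = (of_nat (m choose k) * of_nat (m + k choose k) :: rat)" for k
  define W where "W = (\<Sum>k\<le>m. (-1) ^ k * c k * L k)"
  have "W = (\<Sum>k\<le>m. (-1) ^ k * c k * (\<Sum>j\<le>m. (-1) ^ j * of_nat (k choose j) * L j))"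
    unfolding W_def
  proof (rule sum.cong)
    \<comment> \<open>Extending the inner sum from \<open>k\<close> to \<open>m\<close> adds only
      zero binomials and makes its range independent of \<open>k\<close>, so that the sums can be
      swapped.\<close>
    fix k assume "k \<in> {..m}"
    then have "L k = (\<Sum>j\<le>m. (-1) ^ j * of_nat (k choose j) * L j)"
      unfolding L_def central_choose_binomial_transform[symmetric, of k]
      by (intro sum.mono_neutral_left) auto
    then show "(-1) ^ k * c k * L k =
        (-1) ^ k * c k * (\<Sum>j\<le>m. (-1) ^ j * of_nat (k choose j) * L j)" by simp
  qed simp
  also have "\<dots> = (\<Sum>j\<le>m. \<Sum>k\<le>m. (-1) ^ k * c k * ((-1) ^ j * of_nat (k choose j) * L j))"
    unfolding sum_distrib_left by (rule sum.swap)
  also have "\<dots> = (\<Sum>j\<le>m. (-1) ^ j * L j * ((-1) ^ m * c j))"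
  proof (rule sum.cong)
    fix j assume "j \<in> {..m}"
    then have "(-1) ^ m * c j = (\<Sum>k\<le>m. (-1) ^ k * c k * of_nat (k choose j))"
      using legendre_coefficient_reflection[of j m] by (simp add: c_def mult.assoc)
    then show "(\<Sum>k\<le>m. (-1) ^ k * c k * ((-1) ^ j * of_nat (k choose j) * L j)) =
        (-1) ^ j * L j * ((-1) ^ m * c j)"
      by (simp add: sum_distrib_left mult_ac)
  qed simp
  also have "\<dots> = - W"
    unfolding W_def using assms by (simp add: sum_negf mult_ac)
  finally have "W = 0" by simp
  have pow: "(4 :: rat) ^ (m - k) = 4 ^ m / 4 ^ k" if "k \<le> m" for k
    using that by (simp add: power_diff)
  have "rat_of_int (\<Sum>k\<le>m. (-1) ^ k * int (m choose k) * int (m + k choose k) *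
      int (2 * k choose k) * 4 ^ (m - k)) = 4 ^ m * W"
    unfolding W_def sum_distrib_left of_int_sum
    by (rule sum.cong) (auto simp: L_def c_def pow)
  then show ?thesis unfolding \<open>W = 0\<close> by (simp only: mult_zero_right of_int_eq_0_iff)
qed

section \<open>A second formula for S through exponential generating functions\<close>

lemma central_choose_eq_sum:
  "(2 * n choose n) = (\<Sum>j\<le>n. (n choose j) * (if even j then j choose (j div 2) else 0) * 2 ^ (n - j))"
proof -
  let ?X = "fps_X :: rat fps"
  have mid: "fps_nth ((1 + ?X ^ 2) ^ j) j = (if even j then of_nat (j choose (j div 2)) else 0)" for j
  proof -
    have "fps_nth ((?X ^ 2 + 1) ^ j) j = (\<Sum>i\<le>j. if j = 2 * i then of_nat (j choose i) else 0)"
      unfolding binomial_ring fps_sum_nth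
      by (intro sum.cong) (auto simp: power_mult[symmetric] fps_of_nat[symmetric] fps_X_power_nth)
    also have "\<dots> = (if even j then of_nat (j choose (j div 2)) else 0)"
    proof (cases "even j")
      case True
      then have "(\<Sum>i\<le>j. if j = 2 * i then rat_of_nat (j choose i) else 0) =
          (\<Sum>i\<le>j. if i = j div 2 then of_nat (j choose i) else 0)"
        by (intro sum.cong) auto
      then show ?thesis using True by simp
    qed (auto intro!: sum.neutral)
    finally show ?thesis by (simp add: add.commute)
  qed
  \<comment> \<open>The identity compares the coefficients of \<open>X ^ n\<close> here: the right
    side gives the central coefficient, the left side is expanded in powers of
    \<open>1 + X ^ 2\<close>, whose relevant coefficients are \<open>mid\<close>.\<close>
  have sq: "((1 + ?X ^ 2) + 2 * ?X) ^ n = (1 + ?X) ^ (2 * n)"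
    unfolding power_mult by (simp add: power2_eq_square algebra_simps)
  have "rat_of_nat (2 * n choose n) = fps_nth ((1 + ?X) ^ (2 * n)) n"
  proof -
    have "fps_nth ((?X + 1) ^ (2 * n)) n =
        (\<Sum>i\<le>2 * n. if i = n then of_nat (2 * n choose i) else 0)"
      unfolding binomial_ring fps_sum_nth
      by (intro sum.cong) (auto simp: fps_of_nat[symmetric])
    then show ?thesis by (simp add: add.commute)
  qed
  also have "\<dots> = (\<Sum>j\<le>n. fps_nth (of_nat (n choose j) * (1 + ?X ^ 2) ^ j * (2 * ?X) ^ (n - j)) n)"
    using arg_cong[OF binomial_ring[of "1 + ?X ^ 2" "2 * ?X" n], of "\<lambda>f. fps_nth f n"]
    by (simp only: sq fps_sum_nth)
  also have "\<dots> = (\<Sum>j\<le>n. of_nat (n choose j) * (if even j then of_nat (j choose (j div 2)) else 0)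
      * 2 ^ (n - j))"
  proof (rule sum.cong)
    fix j assume j: "j \<in> {..n}"
    have "of_nat (n choose j) * (1 + ?X ^ 2) ^ j * (2 * ?X) ^ (n - j) =
        fps_const (of_nat (n choose j) * 2 ^ (n - j)) * ((1 + ?X ^ 2) ^ j * ?X ^ (n - j))"
      by (simp add: power_mult_distrib fps_of_nat[symmetric] fps_const_mult[symmetric]
        fps_const_power[symmetric] fps_numeral_fps_const mult_ac del: fps_const_mult fps_const_power)
    then show "fps_nth (of_nat (n choose j) * (1 + ?X ^ 2) ^ j * (2 * ?X) ^ (n - j)) n =
        of_nat (n choose j) * (if even j then of_nat (j choose (j div 2)) else 0) * 2 ^ (n - j)"
      using j by (simp only: fps_mult_left_const_nth fps_X_power_mult_right_nth) (auto simp: mid)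
  qed simp
  also have "\<dots> = of_nat (\<Sum>j\<le>n. (n choose j) * (if even j then j choose (j div 2) else 0) * 2 ^ (n - j))"
    unfolding of_nat_sum by (rule sum.cong) auto
  finally show ?thesis by (simp only: of_nat_eq_iff)
qed

lemma sum_even_indices:
  "(\<Sum>i=0..n::nat. if even i then f (i div 2) else 0) = (\<Sum>k\<le>n div 2. f k :: 'a :: comm_monoid_add)"
proof (induction n)
  case (Suc n)
  then show ?case by (cases "even n") (auto elim!: oddE)
qed simp

text \<open>Let \<open>A\<close> be the exponential generating function of the central binomial
  coefficients. Then \<open>S n / n!\<close> is a coefficient of \<open>A * A\<close>, while
  \<open>central_choose_eq_sum\<close> says \<open>A = B * fps_exp 2\<close>; hence
  \<open>A * A = (B * B) * fps_exp 4\<close>, whose coefficients are the other side.\<close>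

lemma S_eq_sum_central_squares:
  "S n = (\<Sum>k\<le>n div 2. (n choose (2 * k)) * (2 * k choose k)\<^sup>2 * 4 ^ (n - 2 * k))"
proof -
  define A where "A = Abs_fps (\<lambda>k. of_nat (2 * k choose k) / fact k :: rat)"
  \<comment> \<open>\<open>B\<close> is the modified Bessel function \<open>I_0(2x)\<close>.\<close>
  define B where "B = Abs_fps (\<lambda>n. if even n then 1 / (fact (n div 2))\<^sup>2 else (0 :: rat))"
  have AB: "A = B * fps_exp 2"
  proof (rule fps_ext)
    fix n
    have "fps_nth A n = (\<Sum>j\<le>n. of_nat ((n choose j) *
        (if even j then j choose (j div 2) else 0) * 2 ^ (n - j))) / fact n"
      unfolding A_def by (simp add: central_choose_eq_sum[of n])
    also have "\<dots> = (\<Sum>j=0..n. fps_nth B j * fps_nth (fps_exp 2) (n - j))"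
      unfolding sum_divide_distrib atLeast0AtMost
    proof (rule sum.cong)
      fix j assume "j \<in> {..n}"
      moreover have "of_nat (j choose (j div 2)) = (fact j / (fact (j div 2))\<^sup>2 :: rat)" if "even j"
        using that binomial_fact[of "j div 2" j] by (auto elim!: evenE simp: power2_eq_square)
      ultimately show "of_nat ((n choose j) * (if even j then j choose (j div 2) else 0)
          * 2 ^ (n - j)) / fact n = fps_nth B j * fps_nth (fps_exp 2) (n - j)"
        unfolding B_def by (auto simp: binomial_fact field_simps)
    qed simp
    finally show "fps_nth A n = fps_nth (B * fps_exp 2) n" by (simp add: fps_mult_nth)
  qed
  \<comment> \<open>For \<open>n = 2 * k\<close> the Cauchy product is a sum of squares of
    \<open>k choose i\<close> over \<open>(fact k)\<^sup>2\<close>, evaluated by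
    \<open>choose_square_sum\<close>; for odd \<open>n\<close> each term has an odd index.\<close>
  have BB: "fps_nth (B * B) n = (if even n then of_nat (n choose (n div 2)) / (fact (n div 2))\<^sup>2 else 0)" for n
  proof (cases "even n")
    case True
    then obtain k where k: "n = 2 * k" by (elim evenE)
    have "fps_nth (B * B) n =
        (\<Sum>i=0..n. if even i then 1 / (fact (i div 2))\<^sup>2 / (fact (k - i div 2))\<^sup>2 else 0)"
      unfolding fps_mult_nth B_def
      by (rule sum.cong) (auto simp: k elim!: evenE simp flip: right_diff_distrib')
    also have "\<dots> = (\<Sum>i\<le>k. 1 / (fact i)\<^sup>2 / (fact (k - i))\<^sup>2)"
      by (subst sum_even_indices) (simp add: k)
    also have "\<dots> = (\<Sum>i\<le>k. of_nat ((k choose i)\<^sup>2) / (fact k)\<^sup>2)"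
      by (rule sum.cong) (auto simp: binomial_fact power_mult_distrib power_divide)
    also have "\<dots> = of_nat (2 * k choose k) / (fact k)\<^sup>2"
      unfolding choose_square_sum[symmetric] by (simp add: sum_divide_distrib)
    finally show ?thesis by (simp add: k)
  next
    case False
    then have "fps_nth (B * B) n = 0"
      unfolding fps_mult_nth B_def by (intro sum.neutral) auto
    then show ?thesis using False by simp
  qed
  have "A * A = (B * B) * fps_exp 4"
    unfolding AB using fps_exp_add_mult[of "2 :: rat" 2] by (simp add: mult_ac)
  then have "fps_nth (A * A) n = (\<Sum>i=0..n. fps_nth (B * B) i * fps_nth (fps_exp 4) (n - i))"
    by (simp add: fps_mult_nth)
  also have "\<dots> = (\<Sum>i=0..n. if even i then of_nat (2 * (i div 2) choose (i div 2)) /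
      (fact (i div 2))\<^sup>2 * (4 ^ (n - 2 * (i div 2)) / fact (n - 2 * (i div 2))) else 0)"
    by (rule sum.cong) (auto simp: BB)
  also have "\<dots> = (\<Sum>k\<le>n div 2. of_nat (2 * k choose k) / (fact k)\<^sup>2 *
      (4 ^ (n - 2 * k) / fact (n - 2 * k)))"
    by (rule sum_even_indices)
  also have "\<dots> = (\<Sum>k\<le>n div 2. of_nat ((n choose (2 * k)) * (2 * k choose k)\<^sup>2 * 4 ^ (n - 2 * k)) / fact n)"
  proof (rule sum.cong)
    fix k assume "k \<in> {..n div 2}"
    then have "2 * k \<le> n" by auto
    moreover have "of_nat (2 * k choose k) = (fact (2 * k) / (fact k)\<^sup>2 :: rat)"
      using binomial_fact[of k "2 * k"] by (simp add: power2_eq_square)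
    ultimately show "of_nat (2 * k choose k) / (fact k)\<^sup>2 * (4 ^ (n - 2 * k) / fact (n - 2 * k)) =
        (of_nat ((n choose (2 * k)) * (2 * k choose k)\<^sup>2 * 4 ^ (n - 2 * k)) / fact n :: rat)"
      by (simp add: binomial_fact power2_eq_square)
  qed simp
  finally have 1: "fps_nth (A * A) n = of_nat (\<Sum>k\<le>n div 2.
      (n choose (2 * k)) * (2 * k choose k)\<^sup>2 * 4 ^ (n - 2 * k)) / fact n"
    by (simp add: sum_divide_distrib)
  have "fps_nth (A * A) n = of_nat (S n) / fact n"
    unfolding fps_mult_nth S_def of_nat_sum sum_divide_distrib A_def
    by (rule sum.cong) (auto simp: binomial_fact[of _ n] diff_mult_distrib2)
  with 1 have "rat_of_nat (S n) = of_nat (\<Sum>k\<le>n div 2.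
      (n choose (2 * k)) * (2 * k choose k)\<^sup>2 * 4 ^ (n - 2 * k))"
    by simp
  then show ?thesis by (simp only: of_nat_eq_iff)
qed

section \<open>Congruences modulo p and divisibility of S_h by p\<close>

lemma int_choose_Suc:
  assumes "k \<le> n"
  shows "(int k + 1) * int (n choose Suc k) = (int n - int k) * int (n choose k)"
proof -
  have "Suc k * (n choose Suc k) = (n - k) * (n choose k)"
    by (simp only: binomial_absorption binomial_absorb_comp)
  then have "int (Suc k) * int (n choose Suc k) = int (n - k) * int (n choose k)"
    by (metis of_nat_mult)
  then show ?thesis using assms by (simp add: of_nat_diff add.commute)
qed

lemma int_central_choose_Suc:
  "(int k + 1) * int (2 * Suc k choose Suc k) = 2 * (2 * int k + 1) * int (2 * k choose k)"
proof -
  have "int (Suc k * (2 * Suc k choose Suc k)) = int (2 * (2 * k + 1) * (2 * k choose k))"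
    by (simp only: central_choose_Suc)
  then show ?thesis
    by (simp only: of_nat_mult of_nat_Suc of_nat_add of_nat_1 of_nat_numeral add.commute)
qed

lemma coprime_int_Suc_prime:
  fixes p :: nat
  assumes "prime p" "Suc k < p"
  shows "coprime (int k + 1) (int p)"
proof -
  have "coprime (Suc k) p"
    using assms by (metis coprime_commute nat_dvd_not_less prime_imp_coprime zero_less_Suc)
  then have "coprime (int (Suc k)) (int p)" by (simp only: coprime_int_iff)
  then show ?thesis by (simp add: add.commute)
qed

text \<open>The left side is \<open>(-4) ^ k\<close> times the binomial coefficient of -1/2, and
  \<open>h\<close> is -1/2 modulo \<open>p\<close>. The induction compares consecutive ratios; their
  denominator \<open>k + 1\<close> is a unit because \<open>k < h < p\<close>.\<close>

lemma central_choose_cong_half: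
  fixes p h :: nat
  assumes "prime p" "p = 2 * h + 1" "k \<le> h"
  shows "[int (2 * k choose k) = (-4) ^ k * int (h choose k)] (mod int p)"
  using assms(3)
proof (induction k)
  case (Suc k)
  have "(int k + 1) * int (2 * Suc k choose Suc k) = 2 * (2 * int k + 1) * int (2 * k choose k)"
    by (rule int_central_choose_Suc)
  also have "[\<dots> = (-4) * (int h - int k) * ((-4) ^ k * int (h choose k))] (mod int p)"
  proof (rule cong_mult)
    have "2 * (2 * int k + 1) - (-4) * (int h - int k) = int p * 2"
      using assms(2) by (simp add: algebra_simps)
    then show "[2 * (2 * int k + 1) = (-4) * (int h - int k)] (mod int p)"
      by (metis cong_iff_dvd_diff dvd_triv_left)
  qed (use Suc in simp)
  also have "(-4) * (int h - int k) * ((-4) ^ k * int (h choose k)) =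
      (-4) ^ Suc k * ((int h - int k) * int (h choose k))"
    by (simp only: power_Suc mult_ac)
  also have "\<dots> = (int k + 1) * ((-4) ^ Suc k * int (h choose Suc k))"
    unfolding int_choose_Suc[OF Suc_leD[OF Suc.prems], symmetric] by (rule mult.left_commute)
  finally have "[(int k + 1) * int (2 * Suc k choose Suc k) =
      (int k + 1) * ((-4) ^ Suc k * int (h choose Suc k))] (mod int p)" .
  moreover have "coprime (int k + 1) (int p)"
    using coprime_int_Suc_prime[OF assms(1), of k] Suc.prems assms(2) by simp
  ultimately show ?case by (simp only: cong_mult_lcancel)
qed simp

text \<open>Both sides are 1 at \<open>k = 0\<close>, and their consecutive ratios,
  \<open>(h - 2k)(h - 2k - 1) / (k + 1)^2\<close> and
  \<open>-4 (m - k)(m + k + 1) / (k + 1)^2\<close>, agree modulo \<open>p\<close>.\<close>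

lemma choose_cong_quarter:
  fixes p m h :: nat
  assumes "prime p" "(p = 4 * m + 1 \<and> h = 2 * m) \<or> (p = 4 * m + 3 \<and> h = 2 * m + 1)" "k \<le> m"
  shows "[int (h choose (2 * k)) * int (2 * k choose k) =
    (-4) ^ k * (int (m choose k) * int (m + k choose k))] (mod int p)"
  using assms(3)
proof (induction k)
  case (Suc k)
  let ?a = "\<lambda>k. int (h choose (2 * k)) * int (2 * k choose k)"
  let ?c = "\<lambda>k. int (m choose k) * int (m + k choose k)"
  have h: "2 * Suc k \<le> h" using assms(2) Suc.prems by auto
  have "(2 * int k + 2) * int (h choose (2 * Suc k)) = (int h - 2 * int k - 1) * int (h choose Suc (2 * k))"
    using int_choose_Suc[of "Suc (2 * k)" h] h by (simp add: algebra_simps)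
  moreover have "(2 * int k + 1) * int (h choose Suc (2 * k)) = (int h - 2 * int k) * int (h choose (2 * k))"
    using int_choose_Suc[of "2 * k" h] h by (simp add: algebra_simps)
  ultimately have "(2 * int k + 1) * ((2 * int k + 2) * int (h choose (2 * Suc k))) =
      (int h - 2 * int k - 1) * ((int h - 2 * int k) * int (h choose (2 * k)))"
    by (metis mult.left_commute)
  \<comment> \<open>The recurrence for the central coefficient brings in a second factor
    \<open>2 * k + 1\<close>, so \<open>2 * (2 * k + 1)\<close> cancels over the integers and only
    \<open>(k + 1)^2\<close> has to be inverted modulo \<open>p\<close>.\<close>
  then have "((2 * int k + 1) * ((2 * int k + 2) * int (h choose (2 * Suc k)))) *
      ((int k + 1) * int (2 * Suc k choose Suc k)) =
      ((int h - 2 * int k - 1) * ((int h - 2 * int k) * int (h choose (2 * k)))) *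
      (2 * (2 * int k + 1) * int (2 * k choose k))"
    unfolding int_central_choose_Suc by simp
  then have "(2 * (2 * int k + 1)) * ((int k + 1)\<^sup>2 * ?a (Suc k)) =
      (2 * (2 * int k + 1)) * ((int h - 2 * int k - 1) * (int h - 2 * int k) * ?a k)"
    by (simp add: power2_eq_square algebra_simps del: binomial_Suc_Suc mult_Suc_right)
  then have "(int k + 1)\<^sup>2 * ?a (Suc k) = (int h - 2 * int k - 1) * (int h - 2 * int k) * ?a k"
    by simp
  also have "[\<dots> = ((-4) * ((int m - int k) * (int m + int k + 1))) * ((-4) ^ k * ?c k)] (mod int p)"
  proof (rule cong_mult)
    \<comment> \<open>The common factor \<open>2 * (m - k)\<close> leaves \<open>4 * m + 1\<close>
      or \<open>4 * m + 3\<close>, which is \<open>p\<close> in the respective case.\<close>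
    have "(int h - 2 * int k - 1) * (int h - 2 * int k) - (-4) * ((int m - int k) * (int m + int k + 1))
        = int p * (2 * (int m - int k))"
      using assms(2) by (auto simp: algebra_simps)
    then show "[(int h - 2 * int k - 1) * (int h - 2 * int k) =
        (-4) * ((int m - int k) * (int m + int k + 1))] (mod int p)"
      by (metis cong_iff_dvd_diff dvd_triv_left)
  qed (use Suc in simp)
  also have "((-4) * ((int m - int k) * (int m + int k + 1))) * ((-4) ^ k * ?c k) =
      (-4) ^ Suc k * (((int m - int k) * int (m choose k)) *
        ((int m + int k + 1) * int (m + k choose k)))"
    by (simp only: power_Suc mult_ac)
  also have "(int m - int k) * int (m choose k) = (int k + 1) * int (m choose Suc k)"
    using int_choose_Suc[of k m] Suc.prems by simp
  also have "(int m + int k + 1) * int (m + k choose k) = (int k + 1) * int (m + Suc k choose Suc k)"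
  proof -
    have "int (Suc (m + k) * (m + k choose k)) = int (Suc k * (Suc (m + k) choose Suc k))"
      by (simp only: Suc_times_binomial_eq mult.commute)
    then show ?thesis by (simp only: of_nat_mult of_nat_Suc of_nat_add add_Suc_right add_ac)
  qed
  also have "(-4) ^ Suc k * ((int k + 1) * int (m choose Suc k) * ((int k + 1) * int (m + Suc k choose Suc k)))
      = (int k + 1)\<^sup>2 * ((-4) ^ Suc k * ?c (Suc k))"
    by (simp only: power2_eq_square mult_ac)
  finally have "[(int k + 1)\<^sup>2 * ?a (Suc k) = (int k + 1)\<^sup>2 * ((-4) ^ Suc k * ?c (Suc k))] (mod int p)" .
  moreover have "coprime ((int k + 1)\<^sup>2) (int p)"
    using coprime_int_Suc_prime[OF assms(1), of k] Suc.prems assms(2) by auto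
  ultimately show ?case by (simp only: cong_mult_lcancel)
qed simp

lemma prime_dvd_S_half:
  fixes p m h :: nat
  assumes "prime p" "(p = 4 * m + 1 \<and> h = 2 * m) \<or> (p = 4 * m + 3 \<and> h = 2 * m + 1)" "odd m"
  shows "int p dvd int (S h)"
proof -
  have m: "h div 2 = m" using assms(2) by auto
  \<comment> \<open>One of the two central factors joins \<open>h choose (2 * k)\<close> to form the
    left side of \<open>choose_cong_quarter\<close>; the other remains as the circle moment.\<close>
  have eq: "int (S h) = (\<Sum>k\<le>m. int (2 * k choose k) * 4 ^ (h - 2 * k) *
      (int (h choose (2 * k)) * int (2 * k choose k)))"
    unfolding S_eq_sum_central_squares m of_nat_sum
    by (rule sum.cong) (auto simp: power2_eq_square mult_ac)
  have "[int (S h) = (\<Sum>k\<le>m. int (2 * k choose k) * 4 ^ (h - 2 * k) *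
      ((-4) ^ k * (int (m choose k) * int (m + k choose k))))] (mod int p)"
    unfolding eq by (intro cong_sum cong_mult cong_refl choose_cong_quarter[OF assms(1,2)]) simp
  also have "(\<Sum>k\<le>m. int (2 * k choose k) * 4 ^ (h - 2 * k) *
      ((-4) ^ k * (int (m choose k) * int (m + k choose k)))) =
      4 ^ (h - m) * (\<Sum>k\<le>m. (-1) ^ k * int (m choose k) * int (m + k choose k) *
        int (2 * k choose k) * 4 ^ (m - k))"
    unfolding sum_distrib_left
  proof (rule sum.cong)
    fix k assume "k \<in> {..m}"
    then have "(h - 2 * k) + k = (h - m) + (m - k)" using assms(2) unfolding atMost_iff by linarith
    then have "(4 :: int) ^ (h - 2 * k) * 4 ^ k = 4 ^ (h - m) * 4 ^ (m - k)"
      by (metis power_add)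
    moreover have "(-4 :: int) ^ k = (-1) ^ k * 4 ^ k" by (simp flip: power_mult_distrib)
    ultimately have "4 ^ (h - 2 * k) * (-4 :: int) ^ k = (-1) ^ k * (4 ^ (h - m) * 4 ^ (m - k))"
      by (simp only: mult.left_commute)
    then have "(4 ^ (h - 2 * k) * (-4) ^ k) *
        (int (2 * k choose k) * (int (m choose k) * int (m + k choose k))) =
        ((-1) ^ k * (4 ^ (h - m) * 4 ^ (m - k))) *
        (int (2 * k choose k) * (int (m choose k) * int (m + k choose k)))"
      by (rule arg_cong)
    then show "int (2 * k choose k) * 4 ^ (h - 2 * k) *
        ((-4) ^ k * (int (m choose k) * int (m + k choose k))) =
        4 ^ (h - m) * ((-1) ^ k * int (m choose k) * int (m + k choose k) *
        int (2 * k choose k) * 4 ^ (m - k))"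
      by (simp only: mult_ac)
  qed simp
  also have "\<dots> = 0" unfolding odd_legendre_central_sum[OF assms(3)] by simp
  finally show ?thesis by (simp add: cong_0_iff)
qed

text \<open>By \<open>central_choose_cong_half\<close> both central factors of a summand become
  binomials of \<open>h\<close>, equal to \<open>h choose k\<close> by symmetry, and the powers of
  -4 combine to the constant \<open>(-4) ^ h\<close>.\<close>

lemma S_cong_franel_half:
  fixes p h :: nat
  assumes "prime p" "p = 2 * h + 1"
  shows "[int (S h) = (-4) ^ h * int (franel h)] (mod int p)"
proof -
  have eq: "int (S h) = (\<Sum>k=0..h. int (h choose k) * int (2 * k choose k) *
      int (2 * (h - k) choose (h - k)))"
    unfolding S_def by (simp add: diff_mult_distrib2)
  have "[int (S h) = (\<Sum>k=0..h. int (h choose k) * ((-4) ^ k * int (h choose k)) *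
      ((-4) ^ (h - k) * int (h choose (h - k))))] (mod int p)"
    unfolding eq by (intro cong_sum cong_mult cong_refl central_choose_cong_half[OF assms]) auto
  also have "(\<Sum>k=0..h. int (h choose k) * ((-4) ^ k * int (h choose k)) *
      ((-4) ^ (h - k) * int (h choose (h - k)))) = (-4) ^ h * int (franel h)"
    unfolding franel_def of_nat_sum sum_distrib_left
  proof (rule sum.cong)
    fix k assume k: "k \<in> {0..h}"
    then have "(-4 :: int) ^ h = (-4) ^ k * (-4) ^ (h - k)"
      using power_add[of "-4 :: int" k "h - k"] by simp
    then show "int (h choose k) * ((-4) ^ k * int (h choose k)) *
        ((-4) ^ (h - k) * int (h choose (h - k))) = (-4) ^ h * int ((h choose k) ^ 3)"
      using k binomial_symmetric[of k h] by (simp add: power3_eq_cube)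
  qed simp
  finally show ?thesis .
qed

section \<open>Lifting divisibility from p to its square by summing over digits\<close>

lemma sum_base_digits_cong:
  fixes t :: "nat \<Rightarrow> int" and p h :: nat and q :: int
  assumes "h < p" "\<And>k. h < k mod p \<Longrightarrow> q dvd t k"
  shows "[(\<Sum>k=0..p * h + h. t k) = (\<Sum>b\<le>h. \<Sum>a\<le>h. t (p * a + b))] (mod q)"
proof -
  let ?K = "{k \<in> {0..p * h + h}. k mod p \<le> h}"
  have eq: "(\<Sum>k=0..p * h + h. t k) = (\<Sum>k\<in>{0..p * h + h} - ?K. t k) + (\<Sum>k\<in>?K. t k)"
    by (rule sum.subset_diff) auto
  have "[(\<Sum>k=0..p * h + h. t k) = 0 + (\<Sum>k\<in>?K. t k)] (mod q)"
    unfolding eq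
  proof (rule cong_add)
    show "[(\<Sum>k\<in>{0..p * h + h} - ?K. t k) = 0] (mod q)"
      unfolding cong_0_iff by (rule dvd_sum) (auto intro: assms(2))
  qed simp
  also have "(\<Sum>k\<in>?K. t k) = (\<Sum>(b, a)\<in>{..h} \<times> {..h}. t (p * a + b))"
  proof (rule sum.reindex_bij_witness[of _ "\<lambda>(b, a). p * a + b" "\<lambda>k. (k mod p, k div p)"])
    fix k assume "k \<in> ?K"
    then have k: "k \<le> p * h + h" "k mod p \<le> h" by auto
    from div_le_mono[OF k(1), of p] have "k div p \<le> h" using assms(1) by simp
    with k(2) show "(k mod p, k div p) \<in> {..h} \<times> {..h}" by simp
  next
    fix x assume "x \<in> {..h} \<times> {..h}"
    then obtain b a where x: "x = (b, a)" "b \<le> h" "a \<le> h" by auto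
    then have "p * a + b \<le> p * h + h" by (intro add_mono mult_le_mono2)
    then show "(case x of (b, a) \<Rightarrow> p * a + b) \<in> ?K" using x assms(1) by simp
    show "((case x of (b, a) \<Rightarrow> p * a + b) mod p, (case x of (b, a) \<Rightarrow> p * a + b) div p) = x"
      using x assms(1) by simp
  qed simp_all
  finally show ?thesis by (simp add: sum.cartesian_product)
qed

text \<open>With \<open>M = \<Sum> T a\<close> and \<open>N = \<Sum> a * T a\<close>, the double sum
  over digits is \<open>M * M + p * M * X + p * N * Y\<close>. The reflection
  \<open>a \<mapsto> h - a\<close> gives \<open>2 * N = h * M\<close>, so \<open>p\<close> divides
  \<open>N\<close> along with \<open>M\<close>, and every term is a multiple of
  \<open>p^2\<close>.\<close>

lemma square_dvd_digit_sum:
  fixes t T :: "nat \<Rightarrow> int" and p h :: nat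
  assumes p: "p = 2 * h + 1"
    and carry: "\<And>k. h < k mod p \<Longrightarrow> (int p)\<^sup>2 dvd t k"
    and affine: "\<And>b. b \<le> h \<Longrightarrow> \<exists>x y. \<forall>a\<le>h.
      [t (p * a + b) = T a * (T b + int p * (x + int a * y))] (mod (int p)\<^sup>2)"
    and sym: "\<And>a. a \<le> h \<Longrightarrow> T (h - a) = T a"
    and dvd: "int p dvd (\<Sum>a\<le>h. T a)"
  shows "(int p)\<^sup>2 dvd (\<Sum>k=0..p * h + h. t k)"
proof -
  obtain x y where xy: "\<And>a b. a \<le> h \<Longrightarrow> b \<le> h \<Longrightarrow>
      [t (p * a + b) = T a * (T b + int p * (x b + int a * y b))] (mod (int p)\<^sup>2)"
    using affine by metis
  define M where "M = (\<Sum>a\<le>h. T a)"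
  define N where "N = (\<Sum>a\<le>h. int a * T a)"
  have "N = (\<Sum>a\<le>h. int (h - a) * T (h - a))"
    unfolding N_def by (rule sum.reindex_bij_witness[of _ "\<lambda>a. h - a" "\<lambda>a. h - a"]) auto
  also have "\<dots> = (\<Sum>a\<le>h. int h * T a - int a * T a)"
    by (rule sum.cong) (auto simp: sym of_nat_diff algebra_simps)
  also have "\<dots> = int h * M - N"
    unfolding M_def N_def by (simp add: sum_subtractf sum_distrib_left)
  finally have "2 * N = int h * M" by simp
  then have "int p dvd 2 * N" using dvd by (simp add: M_def)
  moreover have "coprime (int p) 2" using p by simp
  ultimately have N: "int p dvd N" using coprime_dvd_mult_right_iff by blast
  have M: "int p dvd M" using dvd by (simp add: M_def)
  have "[(\<Sum>k=0..p * h + h. t k) = (\<Sum>b\<le>h. \<Sum>a\<le>h. t (p * a + b))] (mod (int p)\<^sup>2)"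
    by (rule sum_base_digits_cong) (use p carry in auto)
  also have "[(\<Sum>b\<le>h. \<Sum>a\<le>h. t (p * a + b)) =
      (\<Sum>b\<le>h. \<Sum>a\<le>h. T a * (T b + int p * (x b + int a * y b)))] (mod (int p)\<^sup>2)"
    by (intro cong_sum xy) auto
  also have "(\<Sum>b\<le>h. \<Sum>a\<le>h. T a * (T b + int p * (x b + int a * y b))) =
      (\<Sum>b\<le>h. T b * M + int p * M * x b + int p * N * y b)"
    unfolding M_def N_def by (simp add: algebra_simps sum.distrib sum_distrib_left)
  also have "\<dots> = M * M + int p * M * (\<Sum>b\<le>h. x b) + int p * N * (\<Sum>b\<le>h. y b)"
    by (simp only: sum.distrib sum_distrib_left[symmetric] sum_distrib_right[symmetric] M_def)
  also have "[\<dots> = 0] (mod (int p)\<^sup>2)"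
    unfolding cong_0_iff power2_eq_square
    by (intro dvd_add dvd_mult2 mult_dvd_mono M N dvd_refl)
  finally show ?thesis by (simp add: cong_0_iff)
qed

text \<open>The product of the two corrections carries \<open>p\<^sup>2\<close> and drops out, so
  the correction of a product is linear in \<open>L1\<close> and \<open>L2\<close>, as in the
  product rule.\<close>

lemma cong_affine_mult:
  fixes X1 X2 C1 C2 \<beta>1 \<beta>2 L1 L2 p :: int
  assumes "[X1 = C1 * (\<beta>1 + p * L1)] (mod p\<^sup>2)" "[X2 = C2 * (\<beta>2 + p * L2)] (mod p\<^sup>2)"
  shows "[X1 * X2 = (C1 * C2) * (\<beta>1 * \<beta>2 + p * (\<beta>1 * L2 + \<beta>2 * L1))] (mod p\<^sup>2)"
proof -
  have "[X1 * X2 = C1 * (\<beta>1 + p * L1) * (C2 * (\<beta>2 + p * L2))] (mod p\<^sup>2)"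
    by (intro cong_mult assms)
  also have "C1 * (\<beta>1 + p * L1) * (C2 * (\<beta>2 + p * L2)) =
      (C1 * C2) * (\<beta>1 * \<beta>2 + p * (\<beta>1 * L2 + \<beta>2 * L1)) + p\<^sup>2 * (C1 * C2 * L1 * L2)"
    by (simp add: power2_eq_square algebra_simps)
  also have "[\<dots> = (C1 * C2) * (\<beta>1 * \<beta>2 + p * (\<beta>1 * L2 + \<beta>2 * L1))] (mod p\<^sup>2)"
    by (simp add: cong_iff_dvd_diff)
  finally show ?thesis .
qed

theorem theorem3p5:
  fixes p :: nat
  assumes "prime p" and "p mod 8 = 5 \<or> p mod 8 = 7"
  shows "p^2 dvd S ((p^2 - 1) div 2) \<and> p^2 dvd franel ((p^2 - 1) div 2)"
proof -
  define h where "h = p div 2"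
  define m where "m = p div 4"
  define n where "n = p * h + h"
  \<comment> \<open>For \<open>p = 8 * j + 5\<close> and \<open>p = 8 * j + 7\<close> alike,
    \<open>m = 2 * j + 1\<close>.\<close>
  have p: "p = 2 * h + 1" and hm: "(p = 4 * m + 1 \<and> h = 2 * m) \<or> (p = 4 * m + 3 \<and> h = 2 * m + 1)"
    and m: "odd m"
    using assms(2) unfolding h_def m_def by presburger+
  \<comment> \<open>Both base-\<open>p\<close> digits of the index are \<open>h\<close>, since
    \<open>(p^2 - 1) / 2 = 2 * h * (h + 1)\<close>.\<close>
  have n: "(p^2 - 1) div 2 = n"
    unfolding n_def p by (simp add: power2_eq_square algebra_simps)
  have dvdS: "int p dvd int (S h)" by (rule prime_dvd_S_half[OF assms(1) hm m])
  have dvdF: "int p dvd int (franel h)"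
  proof -
    have "int p dvd (-4) ^ h * int (franel h)"
      using S_cong_franel_half[OF assms(1) p] dvdS cong_dvd_iff by blast
    moreover have "coprime (int p) ((-4) ^ h)"
    proof -
      have "coprime (int p) (2 ^ 2)" by (rule coprime_power_right_iff[THEN iffD2]) (use p in simp)
      then show ?thesis by simp
    qed
    ultimately show ?thesis using coprime_dvd_mult_right_iff by blast
  qed
  have carry: "p dvd (n choose k)" "p dvd (2 * k choose k)" if k: "h < k mod p" for k
  proof -
    have kp: "k = p * (k div p) + k mod p" "k mod p < p" using prime_gt_0_nat[OF assms(1)] by auto
    show "p dvd (n choose k)"
      using prime_dvd_choose_digits[OF assms(1) k kp(2), of h "k div p"] by (simp add: n_def)
    \<comment> \<open>A last digit above \<open>h\<close> carries when doubled, and the digit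
      \<open>2 * (k mod p) - p\<close> left behind is smaller than \<open>k mod p\<close>.\<close>
    have "2 * k = p * (2 * (k div p) + 1) + (2 * (k mod p) - p)"
      using k p by (subst (1) kp(1)) (simp add: algebra_simps)
    moreover have "2 * (k mod p) - p < k mod p" using kp(2) k p by linarith
    ultimately show "p dvd (2 * k choose k)"
      using prime_dvd_choose_digits[OF assms(1) _ kp(2)] kp(1) by metis
  qed
  have idx: "n = p * h + h" "2 * (p * a + b) = p * (2 * a) + 2 * b"
    "n - (p * a + b) = p * (h - a) + (h - b)" if "a \<le> h" "b \<le> h" for a b
    using that unfolding n_def by (auto simp: algebra_simps diff_mult_distrib2)
  have hp: "h < p" and dbl: "\<And>b. b \<le> h \<Longrightarrow> 2 * b < p" and le_double: "\<And>b. b \<le> 2 * (b :: nat)"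
    using p by auto
  have S: "(int p)\<^sup>2 dvd int (S n)"
  proof -
    \<comment> \<open>The parameter \<open>N\<close> serves twice: \<open>t n\<close> are the
      summands in question, \<open>t h\<close> their one-digit model, the \<open>T\<close> of
      \<open>square_dvd_digit_sum\<close>.\<close>
    define t where "t N k = int (N choose k) * int (2 * k choose k) *
      int (2 * (N - k) choose (N - k))" for N k
    have St: "int (S N) = (\<Sum>k=0..N. t N k)" for N
      unfolding S_def t_def by (simp add: diff_mult_distrib2)
    have "(int p)\<^sup>2 dvd (\<Sum>k=0..p * h + h. t n k)"
    proof (rule square_dvd_digit_sum[OF p, where T = "t h"])
      show "(int p)\<^sup>2 dvd t n k" if "h < k mod p" for k
        unfolding t_def power2_eq_square using carry[OF that]
        by (intro dvd_mult2 mult_dvd_mono) auto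
      show "t h (h - a) = t h a" if "a \<le> h" for a
        using that binomial_symmetric[of a h] by (simp add: t_def)
      show "int p dvd (\<Sum>a\<le>h. t h a)" using dvdS by (simp add: St atLeast0AtMost)
      fix b assume b: "b \<le> h"
      obtain u1 v1 where 1: "\<And>A a. a \<le> A \<Longrightarrow> [int (p * A + h choose (p * a + b)) =
          int (A choose a) * (int (h choose b) + int p * (int A * u1 + int a * v1))] (mod (int p)\<^sup>2)"
        using lucas_mod_prime_square[OF assms(1) b hp] by blast
      obtain u2 v2 where 2: "\<And>A a. a \<le> A \<Longrightarrow> [int (p * A + 2 * b choose (p * a + b)) =
          int (A choose a) * (int (2 * b choose b) + int p * (int A * u2 + int a * v2))] (mod (int p)\<^sup>2)"
        using lucas_mod_prime_square[OF assms(1) le_double dbl[OF b]] by blast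
      obtain u3 v3 where 3: "\<And>A a. a \<le> A \<Longrightarrow> [int (p * A + 2 * (h - b) choose (p * a + (h - b))) =
          int (A choose a) * (int (2 * (h - b) choose (h - b)) + int p * (int A * u3 + int a * v3))]
          (mod (int p)\<^sup>2)"
        using lucas_mod_prime_square[OF assms(1) le_double dbl[OF diff_le_self]] by blast
      let ?\<alpha> = "int (h choose b)" and ?\<beta> = "int (2 * b choose b)"
        and ?\<gamma> = "int (2 * (h - b) choose (h - b))"
      show "\<exists>x y. \<forall>a\<le>h. [t n (p * a + b) =
          t h a * (t h b + int p * (x + int a * y))] (mod (int p)\<^sup>2)"
      proof (intro exI allI impI)
        fix a assume a: "a \<le> h"
        have e: "2 * (p * (h - a) + (h - b)) = p * (2 * (h - a)) + 2 * (h - b)" by simp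
        have "[t n (p * a + b) = t h a * (t h b + int p *
            ((?\<alpha> * ?\<beta>) * (int (2 * (h - a)) * u3 + int (h - a) * v3) + ?\<gamma> *
             (?\<alpha> * (int (2 * a) * u2 + int a * v2) + ?\<beta> * (int h * u1 + int a * v1))))]
            (mod (int p)\<^sup>2)"
          unfolding t_def idx(2,3)[OF a b] e
          by (subst idx(1)[OF a b]) (intro cong_affine_mult 1 2 3 a; simp)
        \<comment> \<open>Replacing \<open>int (h - a)\<close> by \<open>int h - int a\<close> and
          collecting terms shows the witnesses \<open>x\<close> and \<open>y\<close>, both free of
          \<open>a\<close>.\<close>
        also have "(?\<alpha> * ?\<beta>) * (int (2 * (h - a)) * u3 + int (h - a) * v3) + ?\<gamma> *
             (?\<alpha> * (int (2 * a) * u2 + int a * v2) + ?\<beta> * (int h * u1 + int a * v1)) =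
            (?\<alpha> * ?\<beta> * int h * (2 * u3 + v3) + ?\<gamma> * ?\<beta> * int h * u1) +
            int a * (?\<gamma> * (?\<alpha> * (2 * u2 + v2) + ?\<beta> * v1) - ?\<alpha> * ?\<beta> * (2 * u3 + v3))"
          using a by (simp add: of_nat_diff algebra_simps)
        finally show "[t n (p * a + b) = t h a * (t h b + int p *
            ((?\<alpha> * ?\<beta> * int h * (2 * u3 + v3) + ?\<gamma> * ?\<beta> * int h * u1) +
            int a * (?\<gamma> * (?\<alpha> * (2 * u2 + v2) + ?\<beta> * v1) - ?\<alpha> * ?\<beta> * (2 * u3 + v3))))]
            (mod (int p)\<^sup>2)" .
      qed
    qed
    then show ?thesis by (simp add: St n_def)
  qed
  have F: "(int p)\<^sup>2 dvd int (franel n)"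
  proof -
    define t where "t N k = int (N choose k) * int (N choose k) * int (N choose k)" for N k
    have Ft: "int (franel N) = (\<Sum>k=0..N. t N k)" for N
      unfolding franel_def t_def by (simp add: power3_eq_cube)
    have "(int p)\<^sup>2 dvd (\<Sum>k=0..p * h + h. t n k)"
    proof (rule square_dvd_digit_sum[OF p, where T = "t h"])
      show "(int p)\<^sup>2 dvd t n k" if "h < k mod p" for k
        unfolding t_def power2_eq_square using carry[OF that]
        by (intro dvd_mult2 mult_dvd_mono) auto
      show "t h (h - a) = t h a" if "a \<le> h" for a
        using that binomial_symmetric[of a h] by (simp add: t_def)
      show "int p dvd (\<Sum>a\<le>h. t h a)" using dvdF by (simp add: Ft atLeast0AtMost)
      fix b assume b: "b \<le> h"
      obtain u v where 1: "\<And>A a. a \<le> A \<Longrightarrow> [int (p * A + h choose (p * a + b)) =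
          int (A choose a) * (int (h choose b) + int p * (int A * u + int a * v))] (mod (int p)\<^sup>2)"
        using lucas_mod_prime_square[OF assms(1) b hp] by blast
      let ?\<alpha> = "int (h choose b)"
      show "\<exists>x y. \<forall>a\<le>h. [t n (p * a + b) =
          t h a * (t h b + int p * (x + int a * y))] (mod (int p)\<^sup>2)"
      proof (intro exI allI impI)
        fix a assume a: "a \<le> h"
        let ?L = "int h * u + int a * v"
        have "[t n (p * a + b) = t h a * (t h b + int p *
            ((?\<alpha> * ?\<alpha>) * ?L + ?\<alpha> * (?\<alpha> * ?L + ?\<alpha> * ?L)))] (mod (int p)\<^sup>2)"
          unfolding t_def n_def by (intro cong_affine_mult 1 a)
        also have "(?\<alpha> * ?\<alpha>) * ?L + ?\<alpha> * (?\<alpha> * ?L + ?\<alpha> * ?L) =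
            3 * ?\<alpha>\<^sup>2 * int h * u + int a * (3 * ?\<alpha>\<^sup>2 * v)"
          by (simp add: power2_eq_square algebra_simps)
        finally show "[t n (p * a + b) = t h a * (t h b + int p *
            (3 * ?\<alpha>\<^sup>2 * int h * u + int a * (3 * ?\<alpha>\<^sup>2 * v)))] (mod (int p)\<^sup>2)" .
      qed
    qed
    then show ?thesis by (simp add: Ft n_def)
  qed
  show ?thesis
    using S F unfolding n by (simp flip: of_nat_power)
qed

end
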